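(* Let $n\ge 1$ be an integer, let $a_1,\dots,a_n\in\mathbb{C}$ with $|a_j|>1$ for all $j$, and let $W(z)=\prod_{j=1}^n(z-a_j)$ and $B(z)=\prod_{j=1}^n\frac{1-\overline{a_j}z}{z-a_j}$. Let $0<k\le 1$ be real and suppose $R\in\mathcal{R}_n(a_1,\dots,a_n)$ has all its zeros in $\{z\in\mathbb{C}:|z|\le k\}$; that is, $R(z)=\frac{P(z)}{W(z)}$ with $P(z)=\alpha_m\prod_{j=1}^m(z-b_j)$, $\alpha_m\ne 0$, $m\le n$, and $|b_j|\le k\le 1$ for $j=1,\dots,m$. Then for every $z\in\mathbb{C}$ with $|z|=1$, $$|R'(z)|\ge\frac12\left\{|B'(z)|+\frac{2m-n(1+k)}{1+k}+2\left(\sum_{j=1}^m\frac{1}{1+|b_j|}-\frac{m}{1+k}\right)\right\}|R(z)|.$$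
   Context: $\mathcal{R}_n(a_1,\dots,a_n)=\{P(z)/W(z): P \text{ a complex polynomial of degree at most } n\}$, where $W(z)=\prod_{j=1}^n(z-a_j)$; the $a_j$ need not be distinct. *)

theory Defs
  imports "HOL-Analysis.Analysis" "HOL-Computational_Algebra.Polynomial"
begin

definition pole_prod :: "nat \<Rightarrow> (nat \<Rightarrow> complex) \<Rightarrow> complex \<Rightarrow> complex" where
  "pole_prod n a z = (\<Prod>j=1..n. z - a j)"

definition blaschke_prod :: "nat \<Rightarrow> (nat \<Rightarrow> complex) \<Rightarrow> complex \<Rightarrow> complex" where
  "blaschke_prod n a z = (\<Prod>j=1..n. (1 - cnj (a j) * z) / (z - a j))"

(* The quotient is a total function: it takes the value 0 at the points a j. *)
definition rational_space :: "nat \<Rightarrow> (nat \<Rightarrow> complex) \<Rightarrow> (complex \<Rightarrow> complex) set" where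
  "rational_space n a = {\<lambda>z. poly P z / pole_prod n a z | P. degree P \<le> n}"

end

theory Submission
  imports Defs
begin

text \<open>Where \<open>R\<close> does not vanish, \<open>z R'/R\<close> is
  \<open>(\<Sum>j. z / (z - b j)) - (\<Sum>j. z / (z - a j))\<close>, and \<open>\<bar>R'/R\<bar>\<close> is at least its real part
  on the unit circle. There \<open>Re (z / (z - b)) \<ge> 1 / (1 + \<bar>b\<bar>)\<close> when \<open>\<bar>b\<bar> \<le> 1\<close>, while
  \<open>1/2 - Re (z / (z - a)) = (\<bar>a\<bar>\<^sup>2 - 1) / (2 \<bar>z - a\<bar>\<^sup>2)\<close>; the sum of the latter over the poles
  is \<open>\<bar>B'\<bar> / 2\<close>. The parameter \<open>k\<close> cancels from the bound.\<close>

text \<open>Expanding with \<open>cmod z = 1\<close> gives |z - c|^2 = 1 + |c|^2 - 2 Re (z * cnj c),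
  while Re (z * cnj (z - c)) = 1 - Re (z * cnj c). Eliminating the mixed term gives the formula,
  which serves both zeros and poles: only the sign of |c|^2 - 1 changes.\<close>

lemma Re_unit_div_diff:
  assumes "cmod z = 1" "z \<noteq> c"
  shows "Re (z / (z - c)) = 1 / 2 - ((cmod c)\<^sup>2 - 1) / (2 * (cmod (z - c))\<^sup>2)"
proof -
  have z: "(Re z)\<^sup>2 + (Im z)\<^sup>2 = 1"
    using assms(1) by (simp add: cmod_power2[symmetric])
  have d: "(cmod (z - c))\<^sup>2 \<noteq> 0"
    using assms(2) by simp
  have "2 * Re (z * cnj (z - c)) = (cmod (z - c))\<^sup>2 - ((cmod c)\<^sup>2 - 1)"
    unfolding cmod_power2 using z by (simp add: power2_eq_square algebra_simps)
  moreover have "Re (z / (z - c)) = Re (z * cnj (z - c)) / (cmod (z - c))\<^sup>2"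
    by (subst complex_div_cnj) (simp add: Re_divide_of_real flip: of_real_power)
  ultimately show ?thesis
    using d by (simp add: field_simps)
qed

text \<open>For |c| at most 1 the correction to 1/2 is nonnegative and decreases in |z - c|, so the
  worst case is |z - c| = 1 + |c|. There it equals (1 - |c|) / (2 (1 + |c|)).\<close>

lemma Re_unit_div_diff_ge:
  assumes "cmod z = 1" "z \<noteq> c" "cmod c \<le> 1"
  shows "1 / (1 + cmod c) \<le> Re (z / (z - c))"
proof -
  define r where "r = cmod c"
  have r: "0 \<le> r" "r \<le> 1" using assms by (auto simp: r_def)
  have "cmod (z - c) \<le> 1 + r"
    using norm_triangle_ineq4[of z c] assms by (simp add: r_def)
  then have "(cmod (z - c))\<^sup>2 \<le> (1 + r)\<^sup>2"
    by (intro power_mono) auto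
  moreover have "0 < (cmod (z - c))\<^sup>2" using assms by simp
  moreover have "0 \<le> 1 - r\<^sup>2" using r by (simp add: power_le_one)
  ultimately have "(1 - r\<^sup>2) / (2 * (1 + r)\<^sup>2) \<le> (1 - r\<^sup>2) / (2 * (cmod (z - c))\<^sup>2)"
    using r by (intro divide_left_mono mult_pos_pos) auto
  moreover have "1 / (1 + r) = 1 / 2 + (1 - r\<^sup>2) / (2 * (1 + r)\<^sup>2)"
    using r by (simp add: divide_simps add_nonneg_eq_0_iff) algebra
  moreover have "Re (z / (z - c)) = 1 / 2 + (1 - r\<^sup>2) / (2 * (cmod (z - c))\<^sup>2)"
    unfolding Re_unit_div_diff[OF assms(1,2)] r_def
    by (simp add: diff_divide_distrib)
  ultimately show ?thesis
    unfolding r_def by linarith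
qed

text \<open>Makes every Blaschke factor unimodular on the circle, as its numerator and denominator
  then have equal modulus.\<close>

lemma unit_circle_one_minus_cnj_mult:
  assumes "cmod z = 1"
  shows "1 - cnj c * z = z * cnj (z - c)"
  using assms complex_norm_square[of z] by (simp add: algebra_simps)

text \<open>Logarithmic differentiation plus the triangle inequality. An upper bound suffices, since
  |B'| stands on the smaller side of the final estimate.\<close>

lemma cmod_deriv_blaschke_prod_le:
  assumes a: "\<forall>j\<in>{1..n}. cmod (a j) > 1" and z: "cmod z = 1"
  shows "cmod (deriv (blaschke_prod n a) z) \<le> (\<Sum>j=1..n. ((cmod (a j))\<^sup>2 - 1) / (cmod (z - a j))\<^sup>2)"
proof -
  define f where "f j w = (1 - cnj (a j) * w) / (w - a j)" for j w
  \<comment> \<open>In the quotient rule the terms containing z cancel, leaving the constant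
    numerator |a|^2 - 1, which is positive for a pole outside the disc.\<close>
  define f' where "f' j = (of_real ((cmod (a j))\<^sup>2 - 1) :: complex) / (z - a j)\<^sup>2" for j
  have za: "z - a j \<noteq> 0" if "j \<in> {1..n}" for j
    using a z that by force
  have norm_f: "cmod (f j z) = 1" if "j \<in> {1..n}" for j
    using za[OF that] z unfolding f_def unit_circle_one_minus_cnj_mult[OF z]
    by (simp add: norm_divide norm_mult flip: complex_cnj_diff)
  have "(f j has_field_derivative f' j) (at z)" if "j \<in> {1..n}" for j
    unfolding f_def f'_def using za[OF that]
    by (auto intro!: derivative_eq_intros simp: power2_eq_square[of "z - a j"] complex_norm_square
        algebra_simps simp del: of_real_power)
  moreover have "f j z \<noteq> 0" if "j \<in> {1..n}" for j
    using norm_f[OF that] by auto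
  ultimately have "((\<lambda>w. \<Prod>j=1..n. f j w) has_field_derivative
      (\<Prod>j=1..n. f j z) * (\<Sum>j=1..n. f' j / f j z)) (at z)"
    by (intro has_field_derivative_prod') auto
  then have "deriv (blaschke_prod n a) z = (\<Prod>j=1..n. f j z) * (\<Sum>j=1..n. f' j / f j z)"
    unfolding f_def blaschke_prod_def[abs_def] by (rule DERIV_imp_deriv)
  also have "cmod \<dots> = cmod (\<Sum>j=1..n. f' j / f j z)"
    using norm_f by (simp add: norm_mult flip: prod_norm)
  also have "\<dots> \<le> (\<Sum>j=1..n. cmod (f' j / f j z))"
    by (rule norm_sum)
  also have "\<dots> = (\<Sum>j=1..n. ((cmod (a j))\<^sup>2 - 1) / (cmod (z - a j))\<^sup>2)"
  proof (rule sum.cong)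
    fix j assume j: "j \<in> {1..n}"
    then have "1 \<le> (cmod (a j))\<^sup>2"
      using a by (auto intro!: one_le_power less_imp_le)
    then show "cmod (f' j / f j z) = ((cmod (a j))\<^sup>2 - 1) / (cmod (z - a j))\<^sup>2"
      by (simp add: norm_divide norm_mult norm_f[OF j] f'_def norm_power del: of_real_diff of_real_power)
  qed simp
  finally show ?thesis .
qed

theorem theorem3:
  fixes n m :: nat and a b :: "nat \<Rightarrow> complex" and k :: real
    and \<alpha> :: complex and P :: "complex poly" and R :: "complex \<Rightarrow> complex"
  assumes "n \<ge> 1"
    and "\<forall>j\<in>{1..n}. cmod (a j) > 1"
    and "0 < k" and "k \<le> 1"
    and "R \<in> rational_space n a"
    and "R = (\<lambda>z. poly P z / pole_prod n a z)"
    and "P = smult \<alpha> (\<Prod>j=1..m. [:- b j, 1:])"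
    and "\<alpha> \<noteq> 0" and "m \<le> n"
    and "\<forall>j\<in>{1..m}. cmod (b j) \<le> k"
  shows "\<forall>z. cmod z = 1 \<longrightarrow>
    cmod (deriv R z) \<ge>
      1 / 2 * (cmod (deriv (blaschke_prod n a) z)
               + (2 * real m - real n * (1 + k)) / (1 + k)
               + 2 * ((\<Sum>j=1..m. 1 / (1 + cmod (b j))) - real m / (1 + k)))
      * cmod (R z)"
proof (intro allI impI)
  fix z assume z: "cmod z = 1"
  define S where "S = (\<Sum>j=1..m. 1 / (1 + cmod (b j)))"
  define T where "T = (\<Sum>j=1..n. ((cmod (a j))\<^sup>2 - 1) / (cmod (z - a j))\<^sup>2)"
  \<comment> \<open>The logarithmic derivative of \<open>R\<close> at \<open>z\<close>, provided
    \<open>R z\<close> is nonzero.\<close>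
  define L where "L = (\<Sum>j=1..m. 1 / (z - b j)) - (\<Sum>j=1..n. 1 / (z - a j))"
  have za: "z - a j \<noteq> 0" if "j \<in> {1..n}" for j
    using assms(2) z that by force
  \<comment> \<open>This holds at the poles too: both quotients are 0 there.\<close>
  have R: "R w = \<alpha> * (\<Prod>j=1..m. w - b j) / (\<Prod>j=1..n. w - a j)" for w
    unfolding assms(6,7) pole_prod_def by (simp add: poly_prod)
  have k_cancels: "1 / 2 * (cmod (deriv (blaschke_prod n a) z)
       + (2 * real m - real n * (1 + k)) / (1 + k) + 2 * (S - real m / (1 + k)))
     = S + cmod (deriv (blaschke_prod n a) z) / 2 - real n / 2"
  proof -
    have "(2 * real m - real n * (1 + k)) / (1 + k) = 2 * (real m / (1 + k)) - real n"
      using assms(3) by (simp add: diff_divide_distrib)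
    then show ?thesis by (simp only:) (simp add: algebra_simps)
  qed
  have "(S + cmod (deriv (blaschke_prod n a) z) / 2 - real n / 2) * cmod (R z) \<le> cmod (deriv R z)"
  \<comment> \<open>A zero on the circle is possible when \<open>k = 1\<close>; the left side is
    then 0. Otherwise \<open>z\<close> differs from every \<open>b j\<close>, so \<open>L\<close> is
    meaningful.\<close>
  proof (cases "R z = 0")
    case False
    then have zb: "z - b j \<noteq> 0" if "j \<in> {1..m}" for j
      using that unfolding R by auto
    have "((\<lambda>w. \<alpha> * (\<Prod>j=1..m. w - b j) / (\<Prod>j=1..n. w - a j)) has_field_derivative R z * L) (at z)"
    proof -
      have b': "((\<lambda>w. \<Prod>j=1..m. w - b j) has_field_derivative
          (\<Prod>j=1..m. z - b j) * (\<Sum>j=1..m. 1 / (z - b j))) (at z)"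
        by (rule has_field_derivative_prod') (use zb in \<open>auto intro!: derivative_eq_intros\<close>)
      have a': "((\<lambda>w. \<Prod>j=1..n. w - a j) has_field_derivative
          (\<Prod>j=1..n. z - a j) * (\<Sum>j=1..n. 1 / (z - a j))) (at z)"
        by (rule has_field_derivative_prod') (use za in \<open>auto intro!: derivative_eq_intros\<close>)
      have nz: "(\<Prod>j=1..n. z - a j) \<noteq> 0" using za by simp
      show ?thesis
        by (rule DERIV_cong[OF DERIV_divide[OF DERIV_cmult[OF b'] a' nz]])
          (use nz in \<open>simp add: R L_def field_simps\<close>)
    qed
    then have deriv_R: "deriv R z = R z * L"
      unfolding R[abs_def, symmetric] by (rule DERIV_imp_deriv)
    have "cmod (deriv (blaschke_prod n a) z) \<le> T"
      unfolding T_def using cmod_deriv_blaschke_prod_le[OF assms(2) z] .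
    moreover have "S \<le> (\<Sum>j=1..m. Re (z / (z - b j)))"
      unfolding S_def using zb assms(4,10) z
      by (intro sum_mono Re_unit_div_diff_ge) force+
    moreover have "(\<Sum>j=1..n. Re (z / (z - a j))) = real n / 2 - T / 2"
    proof -
      have "(\<Sum>j=1..n. Re (z / (z - a j)))
          = (\<Sum>j=1..n. 1 / 2 - ((cmod (a j))\<^sup>2 - 1) / (cmod (z - a j))\<^sup>2 / 2)"
        using za z by (intro sum.cong refl, subst Re_unit_div_diff) auto
      then show ?thesis
        by (simp add: T_def sum_subtractf sum_divide_distrib)
    qed
    ultimately have "S + cmod (deriv (blaschke_prod n a) z) / 2 - real n / 2
        \<le> (\<Sum>j=1..m. Re (z / (z - b j))) - (\<Sum>j=1..n. Re (z / (z - a j)))"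
      by linarith
    also have "\<dots> = Re (z * L)"
      by (simp add: L_def right_diff_distrib sum_distrib_left)
    \<comment> \<open>The factor \<open>z\<close> has modulus 1, so |z L| = |L|.\<close>
    also have "\<dots> \<le> cmod L"
      using complex_Re_le_cmod[of "z * L"] z by (simp add: norm_mult)
    finally show ?thesis
      unfolding deriv_R norm_mult by (metis mult.commute mult_left_mono norm_ge_zero)
  qed simp
  then show "1 / 2 * (cmod (deriv (blaschke_prod n a) z)
       + (2 * real m - real n * (1 + k)) / (1 + k)
       + 2 * ((\<Sum>j=1..m. 1 / (1 + cmod (b j))) - real m / (1 + k))) * cmod (R z)
     \<le> cmod (deriv R z)"
    unfolding S_def[symmetric] k_cancels .
qed

end
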